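(* Let $X$ and $Y$ be real random variables having moments of every order. (i) If $X$ and $Y$ are independent, then $$\mu_{X+Y}=\mu_X\boxplus^H_{-1}\mu_Y=\mu_X\mu_Y\quad\text{in }H\mathbb{R},$$ where $\mu_X\mu_Y$ is the Hurwitz product. (ii) The Hurwitz cumulants and the classical cumulants satisfy, as formal power series, $$K_{-1}^H[\mu_X](z)=z\frac{d}{dz}\log\Psi_X(z)=\sum_{n\ge1}\frac{c_n(X)}{(n-1)!}z^n.$$ In particular, $\kappa_n^{-1}(\mu_X)=\dfrac{c_n(X)}{(n-1)!}$ for every $n\ge1$.
   Context: $\mathbb{N}=\{0,1,2,\dots\}$. $H\mathbb{R}$ is the set of all maps $f:\mathbb{N}\to\mathbb{R}$ with componentwise addition; the Hurwitz product is $(fg)(n)=\sum_{k=0}^n\binom nkf(k)g(n-k)$. $(a)_{\underline{0}}=1$, $(a)_{\underline{n}}=a(a-1)\cdots(a-n+1)$ for $n\ge 1$. For $t\in\mathbb{R}\setminus\mathbb{Z}_{\ge0}$, $(f\boxplus^H_tg)(n)=\sum_{i+j=n}\frac{(t)_{\underline{n}}}{(t)_{\underline{i}}(t)_{\underline{j}}}f(i)g(j)$. For $f\in H\mathbb{R}$ with $f(0)=1$, the $t$-deformed Hurwitz cumulant transform and cumulants are $$K_t^H[f](z)=\sum_{n\ge1}\kappa_n^t(f)z^n=-\frac zt\frac{d}{dz}\log\left(1+\sum_{n\ge1}\frac{t^n}{(t)_{\underline{n}}}f(n)z^n\right)$$ (formal power series, formal logarithm). For a random variable $X$ with moments of every order,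 $\mu_X\in H\mathbb{R}$ is $\mu_X(n)=\mathbb{E}[X^n]$; $\Psi_X(z)=\sum_{n\ge0}\frac{\mathbb{E}[X^n]}{n!}z^n$ (formal power series); and the classical cumulants $c_n(X)$ are defined by $\log\Psi_X(z)=\sum_{n\ge1}\frac{c_n(X)}{n!}z^n$. *)

theory Defs
  imports "HOL-Probability.Probability"
    "HOL-Computational_Algebra.Formal_Power_Series"
begin

text \<open>
  The elements of the ring \<open>H\<real>\<close> of Hurwitz series over \<open>\<real>\<close> are plain sequences.
\<close>

type_synonym hurwitz = "nat \<Rightarrow> real"

definition hurwitz_times :: "hurwitz \<Rightarrow> hurwitz \<Rightarrow> hurwitz" where
  "hurwitz_times f g = (\<lambda>n. \<Sum>k=0..n. of_nat (n choose k) * f k * g (n - k))"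

definition falling_fact :: "real \<Rightarrow> nat \<Rightarrow> real" where
  "falling_fact a n = (\<Prod>i<n. a - of_nat i)"

text \<open>
  The next two operations are meant for \<open>t\<close> outside the non-negative integers; there
  \<open>falling_fact t n\<close> never vanishes and no division by zero occurs.
\<close>

definition hurwitz_conv :: "real \<Rightarrow> hurwitz \<Rightarrow> hurwitz \<Rightarrow> hurwitz" where
  "hurwitz_conv t f g = (\<lambda>n. \<Sum>(i, j)\<in>{(i, j). i + j = n}.
     falling_fact t n / (falling_fact t i * falling_fact t j) * f i * g j)"

text \<open>
  The formal logarithm \<open>log F = (\<Sum>n\<ge>1. (-1)^(n-1)/n * (F - 1)^n)\<close>, for \<open>F\<close> with constant
  coefficient \<open>1\<close>.  The library's \<open>fps_ln 1\<close> is the series of \<open>log (1 + z)\<close>.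
\<close>

definition fps_log :: "real fps \<Rightarrow> real fps" where
  "fps_log F = fps_ln 1 oo (F - 1)"

text \<open>
  The transform is meant for \<open>f\<close> with \<open>f 0 = 1\<close>; the value \<open>f 0\<close> itself does not enter.
\<close>

definition hurwitz_cumulant_transform :: "real \<Rightarrow> hurwitz \<Rightarrow> real fps" where
  "hurwitz_cumulant_transform t f =
     - (fps_const (1 / t) * fps_X * fps_deriv (fps_log
         (1 + Abs_fps (\<lambda>n. if n = 0 then 0 else t ^ n / falling_fact t n * f n))))"

definition hurwitz_cumulant :: "real \<Rightarrow> hurwitz \<Rightarrow> nat \<Rightarrow> real" where
  "hurwitz_cumulant t f n = fps_nth (hurwitz_cumulant_transform t f) n"

definition has_all_moments :: "'a measure \<Rightarrow> ('a \<Rightarrow> real) \<Rightarrow> bool" where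
  "has_all_moments M X \<longleftrightarrow> (\<forall>n::nat. integrable M (\<lambda>\<omega>. X \<omega> ^ n))"

definition moment_seq :: "'a measure \<Rightarrow> ('a \<Rightarrow> real) \<Rightarrow> hurwitz" where
  "moment_seq M X = (\<lambda>n. integral\<^sup>L M (\<lambda>\<omega>. X \<omega> ^ n))"

lemma (in prob_space) moment_seq_0: "moment_seq M X 0 = 1"
  by (simp add: moment_seq_def prob_space)

definition moment_egf :: "'a measure \<Rightarrow> ('a \<Rightarrow> real) \<Rightarrow> real fps" where
  "moment_egf M X = Abs_fps (\<lambda>n. integral\<^sup>L M (\<lambda>\<omega>. X \<omega> ^ n) / fact n)"

text \<open>
  The classical cumulants are the numbers \<open>c n\<close> for which the formal logarithm of the
  exponential moment series is \<open>\<Sum>n\<ge>1. c n / n! * z^n\<close>.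
\<close>

definition classical_cumulant :: "'a measure \<Rightarrow> ('a \<Rightarrow> real) \<Rightarrow> nat \<Rightarrow> real" where
  "classical_cumulant M X n = fact n * fps_nth (fps_log (moment_egf M X)) n"

end

theory Submission
  imports Defs
begin

text \<open>At \<open>t = - 1\<close> the falling factorial is a signed factorial, so both deformed
  notions become classical. In the convolution the signs cancel and the weights turn into binomial
  coefficients (\<open>hurwitz_conv_minus_one\<close>); independence and the binomial theorem give
  the same convolution for the moments of a sum (\<open>moment_seq_add_indep\<close>). In the
  transform the weight \<open>t ^ n / falling_fact t n\<close> is \<open>1 / fact n\<close>, so the
  logarithm is taken of the exponential moment series
  (\<open>hurwitz_cumulant_transform_moment_seq\<close>), and z d/dz multiplies its n-th coefficient
  by n.\<close>

lemma falling_fact_minus_one: "falling_fact (- 1) n = (- 1) ^ n * fact n"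
  by (induction n) (simp_all add: falling_fact_def algebra_simps)

lemma hurwitz_conv_minus_one: "hurwitz_conv (- 1) f g = hurwitz_times f g"
proof
  fix n
  have "hurwitz_conv (- 1) f g n = (\<Sum>k=0..n. falling_fact (- 1) n /
      (falling_fact (- 1) k * falling_fact (- 1) (n - k)) * f k * g (n - k))"
    unfolding hurwitz_conv_def
    by (rule sum.reindex_bij_witness[of _ "\<lambda>k. (k, n - k)" fst]) auto
  also have "\<dots> = hurwitz_times f g n"
    unfolding hurwitz_times_def
  proof (rule sum.cong)
    fix k assume "k \<in> {0..n}"
    then have k: "k \<le> n" by simp
    \<comment> \<open>With \<open>n\<close> split as \<open>k + (n - k)\<close>, the sign of the
      numerator is the product of the two signs below it.\<close>
    then have "(- 1 :: real) ^ n = (- 1) ^ k * (- 1) ^ (n - k)"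
      by (simp flip: power_add)
    with k show "falling_fact (- 1) n / (falling_fact (- 1) k * falling_fact (- 1) (n - k)) * f k * g (n - k)
        = of_nat (n choose k) * f k * g (n - k)"
      by (simp add: falling_fact_minus_one binomial_fact)
  qed simp
  finally show "hurwitz_conv (- 1) f g n = hurwitz_times f g n" .
qed

text \<open>The mixed moments in the binomial expansion of the power of the sum factor by
  independence; what remains is the Hurwitz product.\<close>

lemma (in prob_space)
  assumes "indep_var borel X borel Y" "has_all_moments M X" "has_all_moments M Y"
  shows has_all_moments_add_indep: "has_all_moments M (\<lambda>\<omega>. X \<omega> + Y \<omega>)"
    and moment_seq_add_indep:
      "moment_seq M (\<lambda>\<omega>. X \<omega> + Y \<omega>) = hurwitz_times (moment_seq M X) (moment_seq M Y)"
proof -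
  have indep: "indep_var borel (\<lambda>\<omega>. X \<omega> ^ i) borel (\<lambda>\<omega>. Y \<omega> ^ j)" for i j
    using indep_var_compose[OF assms(1), of "\<lambda>x. x ^ i" borel "\<lambda>y. y ^ j" borel]
    by (simp add: comp_def)
  have int: "integrable M (\<lambda>\<omega>. X \<omega> ^ i)" "integrable M (\<lambda>\<omega>. Y \<omega> ^ i)" for i
    using assms(2,3) by (simp_all add: has_all_moments_def)
  \<comment> \<open>For independent factors the product is itself integrable. This yields the
    moments of the sum and lets the integral pass through the finite sum.\<close>
  note int_prod = indep_var_integrable[OF indep int]
    and expectation_prod = indep_var_lebesgue_integral[OF indep int]
  have expand: "(X \<omega> + Y \<omega>) ^ n = (\<Sum>k\<le>n. of_nat (n choose k) * (X \<omega> ^ k * Y \<omega> ^ (n - k)))" for \<omega> n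
    by (simp add: binomial_ring mult.assoc)
  show "has_all_moments M (\<lambda>\<omega>. X \<omega> + Y \<omega>)"
    unfolding has_all_moments_def expand using int_prod by simp
  show "moment_seq M (\<lambda>\<omega>. X \<omega> + Y \<omega>) = hurwitz_times (moment_seq M X) (moment_seq M Y)"
    unfolding moment_seq_def hurwitz_times_def expand
    using int_prod expectation_prod by (simp add: atLeast0AtMost mult.assoc)
qed

lemma (in prob_space) hurwitz_cumulant_transform_moment_seq:
  "hurwitz_cumulant_transform (- 1) (moment_seq M X) = fps_X * fps_deriv (fps_log (moment_egf M X))"
proof -
  \<comment> \<open>The constant coefficients agree because the total mass is 1; in higher degrees
    the signs cancel.\<close>
  have "1 + Abs_fps (\<lambda>n. if n = 0 then 0 else (- 1) ^ n / falling_fact (- 1) n * moment_seq M X n)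
      = moment_egf M X"
    by (rule fps_ext)
      (simp add: moment_egf_def moment_seq_def falling_fact_minus_one prob_space)
  then show ?thesis
    \<comment> \<open>The factor \<open>1 / t\<close> is -1 here and absorbs the outer minus
      sign.\<close>
    by (simp add: hurwitz_cumulant_transform_def flip: fps_const_neg)
qed

text \<open>Comparison of coefficients: for positive n, n / n! = 1 / (n - 1)!, while the factor
  \<open>fps_X\<close> kills degree 0.\<close>

lemma fps_X_deriv_log_moment_egf:
  "fps_X * fps_deriv (fps_log (moment_egf M X))
     = Abs_fps (\<lambda>n. if n = 0 then 0 else classical_cumulant M X n / fact (n - 1))"
proof (rule fps_ext)
  fix n
  show "fps_nth (fps_X * fps_deriv (fps_log (moment_egf M X))) n
      = fps_nth (Abs_fps (\<lambda>n. if n = 0 then 0 else classical_cumulant M X n / fact (n - 1))) n"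
    by (cases n) (simp_all add: classical_cumulant_def)
qed

theorem theorem4p1:
  fixes M :: "'a measure" and X Y :: "'a \<Rightarrow> real"
  assumes "prob_space M"
    and "X \<in> borel_measurable M" and "has_all_moments M X"
    and "Y \<in> borel_measurable M" and "has_all_moments M Y"
  shows "(prob_space.indep_var M borel X borel Y \<longrightarrow>
            has_all_moments M (\<lambda>\<omega>. X \<omega> + Y \<omega>) \<and>
            moment_seq M (\<lambda>\<omega>. X \<omega> + Y \<omega>)
              = hurwitz_conv (- 1) (moment_seq M X) (moment_seq M Y) \<and>
            hurwitz_conv (- 1) (moment_seq M X) (moment_seq M Y)
              = hurwitz_times (moment_seq M X) (moment_seq M Y)) \<and>
         (hurwitz_cumulant_transform (- 1) (moment_seq M X)
              = fps_X * fps_deriv (fps_log (moment_egf M X)) \<and>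
          fps_X * fps_deriv (fps_log (moment_egf M X))
              = Abs_fps (\<lambda>n. if n = 0 then 0
                              else classical_cumulant M X n / fact (n - 1)) \<and>
          (\<forall>n\<ge>1. hurwitz_cumulant (- 1) (moment_seq M X) n
              = classical_cumulant M X n / fact (n - 1)))"
proof -
  interpret prob_space M by fact
  show ?thesis
    using assms(3,5) has_all_moments_add_indep moment_seq_add_indep
    by (simp add: hurwitz_conv_minus_one hurwitz_cumulant_transform_moment_seq
        fps_X_deriv_log_moment_egf hurwitz_cumulant_def)
qed

end
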